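(* The rule \[ \frac{\Gamma\Rightarrow\Delta,A\qquad A,\Gamma'\Rightarrow\Delta'}{\Gamma,\Gamma'\Rightarrow\Delta,\Delta'}\ \mathrm{Cut} \] is admissible in $\mathsf{G3T}^{i}$; that is, whenever both premisses are derivable in $\mathsf{G3T}^{i}$, so is the conclusion.
   Context: Formulae are generated from a countable set of propositional variables by $A ::= p \mid \bot \mid A\land A \mid A\lor A \mid A\to A$. The calculus $\mathsf{G3T}^{i}$. Sequents $\Gamma\Rightarrow\Delta$ have $\Gamma,\Delta$ finite multisets of formulae. Initial sequents: $p,\Gamma\Rightarrow\Delta,p$ ($p$ a variable) and $\bot,\Gamma\Rightarrow\Delta$. Rules (premisses / conclusion): - $\land\mathrm L$: $A,B,\Gamma\Rightarrow\Delta$ / $A\land B,\Gamma\Rightarrow\Delta$. - $\lor\mathrm L$: $A,\Gamma\Rightarrow\Delta$ and $B,\Gamma\Rightarrow\Delta$ / $A\lor B,\Gamma\Rightarrow\Delta$. - $\to\!\mathrm L$: $A\to B,\Gamma\Rightarrow\Delta,A$ and $B,\Gamma\Rightarrow\Delta$ / $A\to B,\Gamma\Rightarrow\Delta$. - $\land\mathrm R$: $\Gamma\Rightarrow\Delta,A$ and $\Gamma\Rightarrow\Delta,B$ / $\Gamma\Rightarrow\Delta,A\land B$. - $\lor\mathrm R$: $\Gamma\Rightarrow\Delta,A,B$ / $\Gamma\Rightarrow\Delta,A\lor B$. - $\to\!\mathrm R$: $A,\Gamma\Rightarrow B$ / $\Gamma\Rightarrow\Delta,A\to B$. *)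

theory Defs
  imports "HOL-Library.Multiset" "HOL-Library.Countable"
begin

datatype 'v form =
    Var 'v
  | Bot
  | And "'v form" "'v form"
  | Or "'v form" "'v form"
  | Imp "'v form" "'v form"

(* g3ti G D: the sequent with antecedent G and succedent D is derivable in G3T^i.
   ImpL repeats the principal formula in its left premiss only; ImpR discards
   the context D in its premiss. *)
inductive g3ti :: "'v form multiset \<Rightarrow> 'v form multiset \<Rightarrow> bool" where
  Init: "g3ti (add_mset (Var p) G) (add_mset (Var p) D)"
| BotL: "g3ti (add_mset Bot G) D"
| AndL: "g3ti (add_mset A (add_mset B G)) D \<Longrightarrow> g3ti (add_mset (And A B) G) D"
| OrL: "g3ti (add_mset A G) D \<Longrightarrow> g3ti (add_mset B G) D \<Longrightarrow> g3ti (add_mset (Or A B) G) D"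
| ImpL: "g3ti (add_mset (Imp A B) G) (add_mset A D) \<Longrightarrow> g3ti (add_mset B G) D
    \<Longrightarrow> g3ti (add_mset (Imp A B) G) D"
| AndR: "g3ti G (add_mset A D) \<Longrightarrow> g3ti G (add_mset B D) \<Longrightarrow> g3ti G (add_mset (And A B) D)"
| OrR: "g3ti G (add_mset A (add_mset B D)) \<Longrightarrow> g3ti G (add_mset (Or A B) D)"
| ImpR: "g3ti (add_mset A G) {#B#} \<Longrightarrow> g3ti G (add_mset (Imp A B) D)"

end

theory Submission
  imports Defs
begin

text \<open>
  It suffices to treat the context-sharing cut, from \<open>\<Gamma> \<Rightarrow> \<Delta>, A\<close> and \<open>A, \<Gamma> \<Rightarrow> \<Delta>\<close> to \<open>\<Gamma> \<Rightarrow> \<Delta>\<close>: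
  weakening brings the two premisses of the general rule to this form. With shared contexts neither
  derivation heights nor contraction of compound formulae are called for, and the proof is an
  induction on \<open>A\<close> whose cases use invertibility of the rules.

  The rules for conjunction and disjunction are invertible on both sides, so a cut on such a formula
  reduces at once to cuts on its immediate subformulae; falsum can be deleted from a succedent
  without any cut. For a variable or an implication one
  traces the cut formula upwards through the derivation of \<open>\<Gamma> \<Rightarrow> \<Delta>, A\<close>. Wherever \<open>A\<close> is not principal
  the last rule is applied again below the cut, and the other premiss \<open>A, \<Gamma> \<Rightarrow> \<Delta>\<close> is carried along
  by inversion of that same rule or by weakening; a right implication that is not the cut formula simply discards
  the cut formula. A variable ends in an initial sequent, where \<open>p\<close> also occurs in \<open>\<Gamma>\<close> and
  contraction of a variable is enough. An implication \<open>A = B \<rightarrow> C\<close> ends in its own right rule, that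
  is with \<open>B, \<Gamma> \<Rightarrow> C\<close>. Then the other derivation is traced in the same manner until
  \<open>B \<rightarrow> C\<close> is principal there: the traced left premiss is \<open>\<Gamma> \<Rightarrow> \<Delta>, B\<close>, the right one is
  \<open>C, \<Gamma> \<Rightarrow> \<Delta>\<close>, and cuts on \<open>B\<close> and on \<open>C\<close> finish the proof.

  Inversions, variable contraction and both traces are instances of the same two inductions,
  \<open>replace_left\<close> and \<open>replace_right\<close>.
\<close>

section \<open>Weakening\<close>

lemma weakening:
  assumes "g3ti G D"
  shows "g3ti (M + G) (N + D)"
  using assms
proof (induction arbitrary: M N)
  case (Init p G D)
  show ?case using g3ti.Init[of p "M + G" "N + D"] by simp
next
  case (BotL G D)
  show ?case using g3ti.BotL[of "M + G" "N + D"] by simp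
next
  case (AndL A B G D)
  show ?case using g3ti.AndL[of A B "M + G" "N + D"] AndL.IH[of M N] by simp
next
  case (OrL A G D B)
  show ?case using g3ti.OrL[of A "M + G" "N + D" B] OrL.IH[of M N] by simp
next
  case (ImpL A B G D)
  show ?case using g3ti.ImpL[of A B "M + G" "N + D"] ImpL.IH[of M N] by simp
next
  case (AndR G A D B)
  show ?case using g3ti.AndR[of "M + G" A "N + D" B] AndR.IH[of M N] by simp
next
  case (OrR G A B D)
  show ?case using g3ti.OrR[of "M + G" A B "N + D"] OrR.IH[of M N] by simp
next
  case (ImpR A G B D)
  \<comment> \<open>The premiss has no side formulae on the right, so only its antecedent is weakened.\<close>
  show ?case using g3ti.ImpR[of A "M + G" B "N + D"] ImpR.IH[of M "{#}"] by simp
qed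

lemma weaken_left: "g3ti G D \<Longrightarrow> g3ti (add_mset A G) D"
  using weakening[of G D "{#A#}" "{#}"] by simp

lemma weaken_right: "g3ti G D \<Longrightarrow> g3ti G (add_mset A D)"
  using weakening[of G D "{#}" "{#A#}"] by simp

section \<open>Tracing a formula through a derivation\<close>

text \<open>
  Follow an occurrence of \<open>X\<close> in the antecedent upwards, with \<open>M\<close> put in its place. Rules in which \<open>X\<close>
  is passive are repeated; the hypotheses \<open>var\<close> to \<open>imp\<close> say what to do where \<open>X\<close> is principal.
  The predicate \<open>Q\<close> is information about the remaining antecedent that survives the passage from a
  conclusion to a premiss. It is vacuous for inversions; in the cut it is the derivability of a
  sequent over the same antecedent, which changes along with it.
\<close>

lemma replace_left:
  assumes "g3ti (add_mset X G) D" and "Q G"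
    and Q_and: "\<And>A B G. Q (add_mset (And A B) G) \<Longrightarrow> Q (add_mset A (add_mset B G))"
    and Q_or1: "\<And>A B G. Q (add_mset (Or A B) G) \<Longrightarrow> Q (add_mset A G)"
    and Q_or2: "\<And>A B G. Q (add_mset (Or A B) G) \<Longrightarrow> Q (add_mset B G)"
    and Q_imp: "\<And>A B G. Q (add_mset (Imp A B) G) \<Longrightarrow> Q (add_mset B G)"
    and Q_weak: "\<And>A G. Q G \<Longrightarrow> Q (add_mset A G)"
    and var: "\<And>p G D. X = Var p \<Longrightarrow> Q G \<Longrightarrow> g3ti (M + G) (add_mset (Var p) D)"
    and bot: "\<And>G D. X = Bot \<Longrightarrow> Q G \<Longrightarrow> g3ti (M + G) D"
    and conj: "\<And>A B G D. X = And A B \<Longrightarrow> Q G \<Longrightarrow> g3ti (add_mset A (add_mset B G)) D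
      \<Longrightarrow> g3ti (M + G) D"
    and disj: "\<And>A B G D. X = Or A B \<Longrightarrow> Q G \<Longrightarrow> g3ti (add_mset A G) D
      \<Longrightarrow> g3ti (add_mset B G) D \<Longrightarrow> g3ti (M + G) D"
    and imp: "\<And>A B G D. X = Imp A B \<Longrightarrow> Q G \<Longrightarrow> g3ti (M + G) (add_mset A D)
      \<Longrightarrow> g3ti (add_mset B G) D \<Longrightarrow> g3ti (M + G) D"
  shows "g3ti (M + G) D"
  using assms(1,2)
proof (induction "add_mset X G" D arbitrary: G)
  case (Init p G' D)
  from Init.hyps consider "X = Var p" "G = G'" | H where "G = add_mset (Var p) H"
    by (auto simp: add_eq_conv_ex)
  then show ?case
  proof cases
    case 1 then show ?thesis using var Init.prems by simp
  next
    case 2 then show ?thesis using g3ti.Init[of p "M + H" D] by simp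
  qed
next
  case (BotL G' D)
  from BotL.hyps consider "X = Bot" "G = G'" | H where "G = add_mset Bot H"
    by (auto simp: add_eq_conv_ex)
  then show ?case
  proof cases
    case 1 then show ?thesis using bot BotL.prems by simp
  next
    case 2 then show ?thesis using g3ti.BotL[of "M + H" D] by simp
  qed
next
  case (AndL A B G' D)
  from AndL.hyps(3) consider "X = And A B" "G = G'"
    | H where "G = add_mset (And A B) H" "G' = add_mset X H"
    by (auto simp: add_eq_conv_ex)
  then show ?case
  proof cases
    case 1 then show ?thesis using conj AndL.prems AndL.hyps(1) by simp
  next
    case 2
    have "Q (add_mset A (add_mset B H))"
      using AndL.prems unfolding 2(1) by (rule Q_and)
    then show ?thesis
      using AndL.hyps(2)[of "add_mset A (add_mset B H)"] 2 g3ti.AndL[of A B "M + H" D]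
      by (simp add: add_mset_commute)
  qed
next
  case (OrL A G' D B)
  from OrL.hyps(5) consider "X = Or A B" "G = G'"
    | H where "G = add_mset (Or A B) H" "G' = add_mset X H"
    by (auto simp: add_eq_conv_ex)
  then show ?case
  proof cases
    case 1 then show ?thesis using disj OrL.prems OrL.hyps(1,3) by simp
  next
    case 2
    have "Q (add_mset A H)" "Q (add_mset B H)"
      using OrL.prems unfolding 2(1) by (rule Q_or1, rule Q_or2)
    then show ?thesis
      using OrL.hyps(2)[of "add_mset A H"] OrL.hyps(4)[of "add_mset B H"] 2
        g3ti.OrL[of A "M + H" D B]
      by (simp add: add_mset_commute)
  qed
next
  case (ImpL A B G' D)
  have left: "g3ti (M + G) (add_mset A D)"
    using ImpL.hyps(2) ImpL.hyps(5) ImpL.prems by simp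
  from ImpL.hyps(5) consider "X = Imp A B" "G = G'"
    | H where "G = add_mset (Imp A B) H" "G' = add_mset X H"
    by (auto simp: add_eq_conv_ex)
  then show ?case
  proof cases
    case 1 then show ?thesis using imp left ImpL.prems ImpL.hyps(3) by simp
  next
    case 2
    have "Q (add_mset B H)"
      using ImpL.prems unfolding 2(1) by (rule Q_imp)
    then show ?thesis
      using left ImpL.hyps(4)[of "add_mset B H"] 2 g3ti.ImpL[of A B "M + H" D]
      by (simp add: add_mset_commute)
  qed
next
  case (AndR A D B)
  then show ?case by (simp add: g3ti.AndR)
next
  case (OrR A B D)
  then show ?case by (simp add: g3ti.OrR)
next
  case (ImpR A B D)
  show ?case
    using ImpR.hyps(2)[of "add_mset A G"] Q_weak[OF ImpR.prems] g3ti.ImpR[of A "M + G" B]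
    by (simp add: add_mset_commute)
qed

text \<open>
  The dual of \<open>replace_left\<close>. Here \<open>Q\<close> may also depend on the succedent, because it need not survive
  a right implication: if \<open>X\<close> is passive there, it is absent from the premiss. The hypothesis
  \<open>Q_weak\<close> serves the left premiss of a left implication, which keeps the antecedent and
  only adds a formula to the succedent.
\<close>

lemma replace_right:
  assumes "g3ti G (add_mset X D)" and "Q G D"
    and Q_andL: "\<And>A B G D. Q (add_mset (And A B) G) D \<Longrightarrow> Q (add_mset A (add_mset B G)) D"
    and Q_orL1: "\<And>A B G D. Q (add_mset (Or A B) G) D \<Longrightarrow> Q (add_mset A G) D"
    and Q_orL2: "\<And>A B G D. Q (add_mset (Or A B) G) D \<Longrightarrow> Q (add_mset B G) D"
    and Q_impL: "\<And>A B G D. Q (add_mset (Imp A B) G) D \<Longrightarrow> Q (add_mset B G) D"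
    and Q_weak: "\<And>A G D. Q G D \<Longrightarrow> Q G (add_mset A D)"
    and Q_andR1: "\<And>A B G D. Q G (add_mset (And A B) D) \<Longrightarrow> Q G (add_mset A D)"
    and Q_andR2: "\<And>A B G D. Q G (add_mset (And A B) D) \<Longrightarrow> Q G (add_mset B D)"
    and Q_orR: "\<And>A B G D. Q G (add_mset (Or A B) D) \<Longrightarrow> Q G (add_mset A (add_mset B D))"
    and var: "\<And>p G D. X = Var p \<Longrightarrow> Q (add_mset (Var p) G) D
      \<Longrightarrow> g3ti (add_mset (Var p) G) (N + D)"
    and conj: "\<And>A B G D. X = And A B \<Longrightarrow> Q G D \<Longrightarrow> g3ti G (add_mset A D)
      \<Longrightarrow> g3ti G (add_mset B D) \<Longrightarrow> g3ti G (N + D)"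
    and disj: "\<And>A B G D. X = Or A B \<Longrightarrow> Q G D \<Longrightarrow> g3ti G (add_mset A (add_mset B D))
      \<Longrightarrow> g3ti G (N + D)"
    and imp: "\<And>A B G D. X = Imp A B \<Longrightarrow> Q G D \<Longrightarrow> g3ti (add_mset A G) {#B#}
      \<Longrightarrow> g3ti G (N + D)"
  shows "g3ti G (N + D)"
  using assms(1,2)
proof (induction G "add_mset X D" arbitrary: D)
  case (Init p G D')
  from Init.hyps consider "X = Var p" "D = D'" | H where "D = add_mset (Var p) H"
    by (auto simp: add_eq_conv_ex)
  then show ?case
  proof cases
    case 1 then show ?thesis using var Init.prems by simp
  next
    case 2 then show ?thesis using g3ti.Init[of p G "N + H"] by simp
  qed
next
  case (BotL G)
  show ?case by (rule g3ti.BotL)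
next
  case (AndL A B G)
  show ?case
    using AndL.hyps(2)[OF refl Q_andL[OF AndL.prems]] by (rule g3ti.AndL)
next
  case (OrL A G B)
  show ?case
    using OrL.hyps(2)[OF refl Q_orL1[OF OrL.prems]] OrL.hyps(4)[OF refl Q_orL2[OF OrL.prems]]
    by (rule g3ti.OrL)
next
  case (ImpL A B G)
  show ?case
    using ImpL.hyps(2)[of "add_mset A D"] Q_weak[OF ImpL.prems] Q_impL[OF ImpL.prems]
      ImpL.hyps(4) g3ti.ImpL[of A B G "N + D"]
    by (simp add: add_mset_commute)
next
  case (AndR G A D' B)
  from AndR.hyps(5) consider "X = And A B" "D = D'"
    | H where "D = add_mset (And A B) H" "D' = add_mset X H"
    by (auto simp: add_eq_conv_ex)
  then show ?case
  proof cases
    case 1 then show ?thesis using conj AndR.prems AndR.hyps(1,3) by simp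
  next
    case 2
    have "Q G (add_mset A H)" "Q G (add_mset B H)"
      using AndR.prems unfolding 2(1) by (rule Q_andR1, rule Q_andR2)
    then show ?thesis
      using AndR.hyps(2)[of "add_mset A H"] AndR.hyps(4)[of "add_mset B H"] 2
        g3ti.AndR[of G A "N + H" B]
      by (simp add: add_mset_commute)
  qed
next
  case (OrR G A B D')
  from OrR.hyps(3) consider "X = Or A B" "D = D'"
    | H where "D = add_mset (Or A B) H" "D' = add_mset X H"
    by (auto simp: add_eq_conv_ex)
  then show ?case
  proof cases
    case 1 then show ?thesis using disj OrR.prems OrR.hyps(1) by simp
  next
    case 2
    have "Q G (add_mset A (add_mset B H))"
      using OrR.prems unfolding 2(1) by (rule Q_orR)
    then show ?thesis
      using OrR.hyps(2)[of "add_mset A (add_mset B H)"] 2 g3ti.OrR[of G A B "N + H"]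
      by (simp add: add_mset_commute)
  qed
next
  case (ImpR A G B D')
  from ImpR.hyps(3) consider "X = Imp A B" "D = D'" | H where "D = add_mset (Imp A B) H"
    by (auto simp: add_eq_conv_ex)
  then show ?case
  proof cases
    case 1 then show ?thesis using imp ImpR.prems ImpR.hyps(1) by simp
  next
    case 2
    then show ?thesis using ImpR.hyps(1) g3ti.ImpR[of A G B "N + H"] by simp
  qed
qed

section \<open>Invertible rules and contraction of variables\<close>

lemma AndL_inv: "g3ti (add_mset (And A B) G) D \<Longrightarrow> g3ti (add_mset A (add_mset B G)) D"
  by (drule replace_left[where Q = "\<lambda>_. True" and M = "{#A, B#}"]) auto

lemma OrL_inv1: "g3ti (add_mset (Or A B) G) D \<Longrightarrow> g3ti (add_mset A G) D"
  by (drule replace_left[where Q = "\<lambda>_. True" and M = "{#A#}"]) auto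

lemma OrL_inv2: "g3ti (add_mset (Or A B) G) D \<Longrightarrow> g3ti (add_mset B G) D"
  by (drule replace_left[where Q = "\<lambda>_. True" and M = "{#B#}"]) auto

lemma ImpL_inv: "g3ti (add_mset (Imp A B) G) D \<Longrightarrow> g3ti (add_mset B G) D"
  by (drule replace_left[where Q = "\<lambda>_. True" and M = "{#B#}"]) auto

lemma BotR_inv: "g3ti G (add_mset Bot D) \<Longrightarrow> g3ti G D"
  by (drule replace_right[where Q = "\<lambda>_ _. True" and N = "{#}"]) auto

lemma AndR_inv1: "g3ti G (add_mset (And A B) D) \<Longrightarrow> g3ti G (add_mset A D)"
  by (drule replace_right[where Q = "\<lambda>_ _. True" and N = "{#A#}"]) auto

lemma AndR_inv2: "g3ti G (add_mset (And A B) D) \<Longrightarrow> g3ti G (add_mset B D)"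
  by (drule replace_right[where Q = "\<lambda>_ _. True" and N = "{#B#}"]) auto

lemma OrR_inv: "g3ti G (add_mset (Or A B) D) \<Longrightarrow> g3ti G (add_mset A (add_mset B D))"
  by (drule replace_right[where Q = "\<lambda>_ _. True" and N = "{#A, B#}"]) auto

text \<open>
  No left rule has a variable as its principal formula, so the second copy of \<open>p\<close> persists up to every
  initial sequent: \<open>Q\<close> is membership of \<open>p\<close> in the remaining antecedent.
\<close>

lemma var_contraction:
  assumes "g3ti (add_mset (Var p) (add_mset (Var p) G)) D"
  shows "g3ti (add_mset (Var p) G) D"
proof -
  have ax: "g3ti G' (add_mset (Var p) D')" if "Var p \<in># G'" for G' D'
    using that g3ti.Init by (metis insert_DiffM)
  show ?thesis
    using replace_left[OF assms, where Q = "\<lambda>G. Var p \<in># G" and M = "{#}"] ax by auto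
qed

section \<open>Cut\<close>

text \<open>
  Tracing \<open>A \<rightarrow> B\<close> through the right premiss of a cut whose left premiss was obtained by the right
  implication rule from \<open>A, G \<Rightarrow> B\<close>. That premiss has a fixed succedent, which is why it
  survives the passage through a right implication on the other side.
\<close>

lemma cut_imp_principal:
  assumes cutA: "\<And>G D. g3ti G (add_mset A D) \<Longrightarrow> g3ti (add_mset A G) D \<Longrightarrow> g3ti G D"
    and cutB: "\<And>G D. g3ti G (add_mset B D) \<Longrightarrow> g3ti (add_mset B G) D \<Longrightarrow> g3ti G D"
    and prem: "g3ti (add_mset A G) {#B#}"
    and deriv: "g3ti (add_mset (Imp A B) G) D"
  shows "g3ti G D"
proof -
  let ?Q = "\<lambda>G. g3ti (add_mset A G) {#B#}"
  have principal: "g3ti G D"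
    if "?Q G" "g3ti G (add_mset A D)" "g3ti (add_mset B G) D" for G D
  proof (rule cutB)
    show "g3ti G (add_mset B D)"
    proof (rule cutA)
      show "g3ti G (add_mset A (add_mset B D))"
        using weaken_right[OF that(2), of B] by (simp add: add_mset_commute)
      show "g3ti (add_mset A G) (add_mset B D)"
        using weakening[OF that(1), of "{#}" D] by simp
    qed
  qed (fact that(3))
  have "g3ti ({#} + G) D"
  proof (rule replace_left[where Q = ?Q, OF deriv prem])
    fix C E G
    show "?Q (add_mset (And C E) G) \<Longrightarrow> ?Q (add_mset C (add_mset E G))"
      using AndL_inv[of C E "add_mset A G"] by (simp add: add_mset_commute)
    show "?Q (add_mset (Or C E) G) \<Longrightarrow> ?Q (add_mset C G)"
      using OrL_inv1[of C E "add_mset A G"] by (simp add: add_mset_commute)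
    show "?Q (add_mset (Or C E) G) \<Longrightarrow> ?Q (add_mset E G)"
      using OrL_inv2[of C E "add_mset A G"] by (simp add: add_mset_commute)
    show "?Q (add_mset (Imp C E) G) \<Longrightarrow> ?Q (add_mset E G)"
      using ImpL_inv[of C E "add_mset A G"] by (simp add: add_mset_commute)
    show "?Q G \<Longrightarrow> ?Q (add_mset C G)"
      using weaken_left[of "add_mset A G" _ C] by (simp add: add_mset_commute)
  qed (use principal in auto)
  then show ?thesis by simp
qed

text \<open>
  Tracing the cut formula through the left premiss, with the right premiss as the accompanying
  information; inversion makes it follow every change of the context. What remains is to cut where
  the cut formula is principal on the left.
\<close>

lemma cut_by_left_trace:
  assumes "g3ti G (add_mset X D)" and "g3ti (add_mset X G) D"
    and var: "\<And>p G D. X = Var p \<Longrightarrow> g3ti (add_mset X (add_mset (Var p) G)) D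
      \<Longrightarrow> g3ti (add_mset (Var p) G) D"
    and conj: "\<And>A B G D. X = And A B \<Longrightarrow> g3ti (add_mset X G) D \<Longrightarrow> g3ti G (add_mset A D)
      \<Longrightarrow> g3ti G (add_mset B D) \<Longrightarrow> g3ti G D"
    and disj: "\<And>A B G D. X = Or A B \<Longrightarrow> g3ti (add_mset X G) D
      \<Longrightarrow> g3ti G (add_mset A (add_mset B D)) \<Longrightarrow> g3ti G D"
    and imp: "\<And>A B G D. X = Imp A B \<Longrightarrow> g3ti (add_mset X G) D \<Longrightarrow> g3ti (add_mset A G) {#B#}
      \<Longrightarrow> g3ti G D"
  shows "g3ti G D"
proof -
  let ?Q = "\<lambda>G D. g3ti (add_mset X G) D"
  have "g3ti G ({#} + D)"
  proof (rule replace_right[where Q = ?Q, OF assms(1,2)])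
    fix A B G D
    show "?Q (add_mset (And A B) G) D \<Longrightarrow> ?Q (add_mset A (add_mset B G)) D"
      using AndL_inv[of A B "add_mset X G"] by (simp add: add_mset_commute)
    show "?Q (add_mset (Or A B) G) D \<Longrightarrow> ?Q (add_mset A G) D"
      using OrL_inv1[of A B "add_mset X G"] by (simp add: add_mset_commute)
    show "?Q (add_mset (Or A B) G) D \<Longrightarrow> ?Q (add_mset B G) D"
      using OrL_inv2[of A B "add_mset X G"] by (simp add: add_mset_commute)
    show "?Q (add_mset (Imp A B) G) D \<Longrightarrow> ?Q (add_mset B G) D"
      using ImpL_inv[of A B "add_mset X G"] by (simp add: add_mset_commute)
    show "?Q G D \<Longrightarrow> ?Q G (add_mset A D)"
      by (rule weaken_right)
    show "?Q G (add_mset (And A B) D) \<Longrightarrow> ?Q G (add_mset A D)"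
      by (rule AndR_inv1)
    show "?Q G (add_mset (And A B) D) \<Longrightarrow> ?Q G (add_mset B D)"
      by (rule AndR_inv2)
    show "?Q G (add_mset (Or A B) D) \<Longrightarrow> ?Q G (add_mset A (add_mset B D))"
      by (rule OrR_inv)
  qed (unfold add_0, (rule var conj disj imp; assumption)+)
  then show ?thesis by simp
qed

theorem shared_cut: "g3ti G (add_mset A D) \<Longrightarrow> g3ti (add_mset A G) D \<Longrightarrow> g3ti G D"
proof (induction A arbitrary: G D)
  case (Var p)
  then show ?case by (rule cut_by_left_trace) (auto intro: var_contraction)
next
  case Bot
  then show ?case using BotR_inv by blast
next
  case (And A B)
  show ?case
  proof (rule And.IH(2))
    show "g3ti G (add_mset B D)"
      using And.prems(1) by (rule AndR_inv2)
    show "g3ti (add_mset B G) D"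
      using And.IH(1) AndL_inv[OF And.prems(2)] weaken_left[OF AndR_inv1[OF And.prems(1)]] by blast
  qed
next
  case (Or A B)
  show ?case
  proof (rule Or.IH(2))
    show "g3ti G (add_mset B D)"
      using Or.IH(1) OrR_inv[OF Or.prems(1)] weaken_right[OF OrL_inv1[OF Or.prems(2)]] by blast
    show "g3ti (add_mset B G) D"
      using Or.prems(2) by (rule OrL_inv2)
  qed
next
  case (Imp A B)
  from Imp.prems show ?case
    by (rule cut_by_left_trace) (auto intro: cut_imp_principal[OF Imp.IH])
qed

theorem corollary5p11:
  fixes A :: "('v :: countable) form"
    and \<Gamma> \<Gamma>' \<Delta> \<Delta>' :: "'v form multiset"
  assumes "g3ti \<Gamma> (add_mset A \<Delta>)"
    and "g3ti (add_mset A \<Gamma>') \<Delta>'"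
  shows "g3ti (\<Gamma> + \<Gamma>') (\<Delta> + \<Delta>')"
proof (rule shared_cut)
  show "g3ti (\<Gamma> + \<Gamma>') (add_mset A (\<Delta> + \<Delta>'))"
    using weakening[OF assms(1), of \<Gamma>' \<Delta>'] by (simp add: add.commute)
  show "g3ti (add_mset A (\<Gamma> + \<Gamma>')) (\<Delta> + \<Delta>')"
    using weakening[OF assms(2), of \<Gamma> \<Delta>] by simp
qed

end
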